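(* Let $\{\alpha_i\}_{i\in\mathbb{N}}\subset\mathbb{T}$ be rationally independent numbers. Then there exists an increasing sequence $(m_n)_{n=1}^{+\infty}$ of natural numbers such that: (a) for every irrational $\theta\in\mathbb{R}\setminus\mathbb{Q}$ the sequence $(m_n\theta[1])_{n\geq 1}$ is dense in $\mathbb{T}$; (b) for every $\epsilon>0$ and every $k\in\mathbb{N}$ there exists $N_0\in\mathbb{N}$ such that for every $n\geq N_0$ the inequality $\|m_n\alpha_i\|<\epsilon$ holds for at least $k-1$ of the indices $i\in\{1,\dots,k\}$; (c) for every integer $k\geq 2$ the set $\{n\in\mathbb{N}: k\nmid m_n\}$ is infinite.
   Context: $\mathbb{T}=\mathbb{R}/\mathbb{Z}$ is the circle group with addition mod $1$, and $\mathbb{N}=\{1,2,3,\dots\}$. For $\eta\in\mathbb{R}$, $\eta[1]$ denotes the fractional part of $\eta$ (viewed as a point of $\mathbb{T}$) and $\|\eta\|$ the distance from $\eta$ to the nearest integer; $\|\cdot\|$ is well defined on $\mathbb{T}$. The family $\{\alpha_i\}_{i\in\mathbb{N}}\subset\mathbb{T}$ is rationally independent if every finite subcollection is: for every $n$ and integers $k_1,\dots,k_n$, if $\sum_{i=1}^n k_i\alpha_i=0$ in $\mathbb{T}$ then $k_1=\dots=k_n=0$ (equivalently, for real representatives, $1,\alpha_1,\dots,\alpha_n$ are linearly independent over $\mathbb{Q}$ for every $n$). *)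

theory Defs
  imports "HOL-Analysis.Analysis"
begin

quotient_type circle = real / "\<lambda>x y :: real. x - y \<in> \<int>"
  morphisms Rep_circle Abs_circle
proof (rule equivpI)
  show "reflp (\<lambda>x y :: real. x - y \<in> \<int>)"
    by (simp add: reflp_def)
  show "symp (\<lambda>x y :: real. x - y \<in> \<int>)"
  proof (rule sympI)
    fix x y :: real
    assume "x - y \<in> \<int>"
    then have "- (x - y) \<in> \<int>" by (rule Ints_minus)
    then show "y - x \<in> \<int>" by simp
  qed
  show "transp (\<lambda>x y :: real. x - y \<in> \<int>)"
  proof (rule transpI)
    fix x y z :: real
    assume "x - y \<in> \<int>" "y - z \<in> \<int>"
    then have "(x - y) + (y - z) \<in> \<int>" by (rule Ints_add)
    then show "x - z \<in> \<int>" by simp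
  qed
qed

lift_definition circle_of :: "real \<Rightarrow> circle" is "\<lambda>x. x" .

lemma circle_of_eq_iff: "circle_of x = circle_of y \<longleftrightarrow> x - y \<in> \<int>"
  by transfer simp

lemma circle_of_frac: "circle_of (frac x) = circle_of x"
  by (simp add: circle_of_eq_iff frac_def)

instantiation circle :: ab_group_add
begin

lift_definition zero_circle :: circle is "0 :: real" .

lift_definition plus_circle :: "circle \<Rightarrow> circle \<Rightarrow> circle" is "(+) :: real \<Rightarrow> real \<Rightarrow> real"
  by (simp only: add_diff_add Ints_add)

lift_definition uminus_circle :: "circle \<Rightarrow> circle" is "uminus :: real \<Rightarrow> real"
  by (simp only: minus_diff_minus Ints_minus)

lift_definition minus_circle :: "circle \<Rightarrow> circle \<Rightarrow> circle" is "(-) :: real \<Rightarrow> real \<Rightarrow> real"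
proof -
  fix a b c d :: real
  assume "a - b \<in> \<int>" "c - d \<in> \<int>"
  then have "(a - b) - (c - d) \<in> \<int>" by (rule Ints_diff)
  then show "(a - c) - (b - d) \<in> \<int>" by (simp add: algebra_simps)
qed

instance
  by standard (transfer; simp)+

end

instantiation circle :: topological_space
begin

definition open_circle :: "circle set \<Rightarrow> bool"
  where "open_circle U \<longleftrightarrow> open (circle_of -` U)"

instance
proof
  show "open (UNIV :: circle set)"
    by (simp add: open_circle_def)
  show "open (S \<inter> T)" if "open S" "open T" for S T :: "circle set"
    using that by (simp add: open_circle_def open_Int)
  show "open (\<Union> K)" if "\<forall>S\<in>K. open S" for K :: "circle set set"
    using that by (auto simp: open_circle_def vimage_Union)
qed

end

lift_definition circle_scale :: "int \<Rightarrow> circle \<Rightarrow> circle" is "\<lambda>k x. of_int k * x"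
  by (simp add: Ints_mult Ints_of_int flip: right_diff_distrib)

lemma circle_scale_simps:
  "circle_scale 0 x = 0"
  "circle_scale 1 x = x"
  "circle_scale (k + l) x = circle_scale k x + circle_scale l x"
  by (transfer; simp add: algebra_simps)+

lemma infdist_Ints_cong:
  fixes x y :: real
  assumes "x - y \<in> \<int>"
  shows "infdist x \<int> = infdist y \<int>"
proof -
  have le: "infdist u \<int> \<le> infdist v \<int>" if "u - v \<in> \<int>" for u v :: real
  proof -
    have ne: "(\<int> :: real set) \<noteq> {}" by auto
    have "infdist u \<int> \<le> dist v a" if "a \<in> \<int>" for a
    proof -
      have "a + (u - v) \<in> \<int>" using that \<open>u - v \<in> \<int>\<close> by (rule Ints_add)
      then have "infdist u \<int> \<le> dist u (a + (u - v))" by (rule infdist_le)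
      also have "\<dots> = dist v a" by (simp add: dist_real_def)
      finally show ?thesis .
    qed
    then show ?thesis
      using ne by (simp add: infdist_notempty[of _ v] cINF_greatest)
  qed
  have "y - x \<in> \<int>" using Ints_minus[OF assms] by simp
  with assms show ?thesis by (intro antisym le)
qed

lift_definition circle_norm :: "circle \<Rightarrow> real" is "\<lambda>x. infdist x \<int>"
  by (rule infdist_Ints_cong)

text \<open>Families and sequences are indexed by the positive naturals; index 0 is ignored.\<close>

definition rationally_independent :: "(nat \<Rightarrow> circle) \<Rightarrow> bool"
  where "rationally_independent \<alpha> \<longleftrightarrow>
    (\<forall>n. \<forall>k :: nat \<Rightarrow> int.
       (\<Sum>i = 1..n. circle_scale (k i) (\<alpha> i)) = 0 \<longrightarrow> (\<forall>i \<in> {1..n}. k i = 0))"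

end

(*
The sequence enumerates a union of finite sets F_k, where every m in F_k satisfies ||m alpha_i|| < 1/k
for all but at most one i <= k. By Kronecker's theorem, the multiples of theta by such m are 1/k-dense in
the circle unless theta is a rational with denominator at most k: a rational with larger denominator is
handled by prescribing m modulo that denominator, and an irrational one is independent of the alpha_i once
a suitable alpha_j is dropped. By compactness a finite F_k therefore serves all theta outside a neighbourhood
of the rationals with denominator at most k. The radius 1/(2k(k+1)) is small enough that no irrational
lies in these neighbourhoods for all large k, so each irrational is served by infinitely many F_k. A further
element congruent to 1 modulo k! is put into F_k to get non-divisibility.
*)
theory Submission
  imports Defs "HOL-Number_Theory.Cong"
begin

section \<open>Distance to the integers and independence modulo 1\<close>

lemma infdist_Ints_less_iff:
  "infdist x \<int> < e \<longleftrightarrow> (\<exists>z :: int. \<bar>x - of_int z\<bar> < e)"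
  for x :: real
proof
  assume "infdist x \<int> < e"
  moreover have ne: "(\<int> :: real set) \<noteq> {}" using Ints_0 by blast
  ultimately have "(INF a\<in>(\<int> :: real set). dist x a) < e"
    by (simp add: infdist_notempty)
  then obtain a :: real where "a \<in> \<int>" "dist x a < e"
    using cInf_lessD[of "dist x ` \<int>" e] ne by blast
  then show "\<exists>z :: int. \<bar>x - of_int z\<bar> < e"
    by (auto simp: dist_real_def elim!: Ints_cases)
next
  assume "\<exists>z :: int. \<bar>x - of_int z\<bar> < e"
  then show "infdist x \<int> < e"
    by (metis Ints_of_int dist_real_def infdist_le le_less_trans)
qed

text \<open>Asking for an integer sum instead of a zero sum tacitly puts 1 among the numbers: this
  is linear independence over the rationals of 1 together with the family.\<close>

definition independent_mod1 :: "'i set \<Rightarrow> ('i \<Rightarrow> real) \<Rightarrow> bool"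
  where "independent_mod1 I x \<longleftrightarrow>
    (\<forall>c :: 'i \<Rightarrow> int. (\<Sum>i\<in>I. of_int (c i) * x i) \<in> \<int> \<longrightarrow> (\<forall>i\<in>I. c i = 0))"

lemma independent_mod1D:
  "independent_mod1 I x \<Longrightarrow> (\<Sum>i\<in>I. of_int (c i) * x i) \<in> \<int> \<Longrightarrow> i \<in> I \<Longrightarrow> c i = 0"
  unfolding independent_mod1_def by blast

text \<open>Prepares for prescribed residues: times \<open>c + q * m\<close> are governed by the
  multiples of \<open>q * x i\<close>.\<close>

lemma independent_mod1_scale:
  assumes "independent_mod1 I x" "q \<noteq> 0"
  shows "independent_mod1 I (\<lambda>i. of_int q * x i)"
  unfolding independent_mod1_def
proof (intro allI impI ballI)
  fix c :: "'a \<Rightarrow> int" and i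
  assume "(\<Sum>i\<in>I. of_int (c i) * (of_int q * x i)) \<in> \<int>" "i \<in> I"
  then have "c i * q = 0"
    by (intro independent_mod1D[OF assms(1), of "\<lambda>i. c i * q"]) (simp_all add: mult.assoc)
  with assms(2) show "c i = 0" by simp
qed

text \<open>This lemma and the next yield the injectivity that \<open>Kronecker_thm_2\<close>
  demands: the \<open>x i\<close> are distinct from each other and from the 1 that is adjoined to
  them.\<close>

lemma independent_mod1_imp_not_Ints_diff:
  assumes "independent_mod1 I x" "finite I" "i \<in> I" "j \<in> I" "i \<noteq> j"
  shows "x i - x j \<notin> \<int>"
proof
  assume *: "x i - x j \<in> \<int>"
  define c :: "'a \<Rightarrow> int" where "c = (\<lambda>_. 0)(i := 1, j := -1)"
  have "(\<Sum>l\<in>I. of_int (c l) * x l) = (\<Sum>l\<in>{i, j}. of_int (c l) * x l)"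
    by (rule sum.mono_neutral_right) (use assms in \<open>auto simp: c_def\<close>)
  also have "\<dots> = x i - x j"
    using assms by (simp add: c_def)
  finally have "c i = 0"
    using * assms by (intro independent_mod1D[OF assms(1)]) auto
  then show False using assms by (simp add: c_def)
qed

lemma independent_mod1_imp_not_Ints:
  assumes "independent_mod1 I x" "finite I" "i \<in> I"
  shows "x i \<notin> \<int>"
proof
  assume *: "x i \<in> \<int>"
  define c :: "'a \<Rightarrow> int" where "c = (\<lambda>_. 0)(i := 1)"
  have "(\<Sum>l\<in>I. of_int (c l) * x l) = (\<Sum>l\<in>{i}. of_int (c l) * x l)"
    by (rule sum.mono_neutral_right) (use assms in \<open>auto simp: c_def\<close>)
  also have "\<dots> = x i"
    by (simp add: c_def)
  finally have "c i = 0"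
    using * assms by (intro independent_mod1D[OF assms(1)]) auto
  then show False by (simp add: c_def)
qed

section \<open>Kronecker's theorem with natural multipliers, residues and an exchange
  property\<close>

lemma Kronecker_int:
  assumes "finite I" "independent_mod1 I x" "\<epsilon> > 0"
  obtains k :: int where "\<And>i. i \<in> I \<Longrightarrow> infdist (of_int k * x i - b i) \<int> < \<epsilon>"
proof -
  obtain h where h: "bij_betw h {..<card I} I"
    using ex_bij_betw_nat_finite[OF assms(1)] by (auto simp: atLeast0LessThan)
  define n where "n = card I"
  \<comment> \<open>\<open>Kronecker_thm_2\<close> expects a list whose last entry is 1.\<close>
  define y where "y = (\<lambda>i. if i < n then x (h i) else 1)"
  \<comment> \<open>The reals as a module over the integers, so that \<open>independent\<close>
    below refers to integer coefficients.\<close>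
  interpret Modules.module "(\<lambda>r. (*) (real_of_int r))"
    by (simp add: Modules.module.intro distrib_left mult.commute)
  have hI: "h i \<in> I" if "i < n" for i
    using h that by (auto simp: bij_betw_def n_def)
  have hinj: "h i \<noteq> h j" if "i < n" "j < n" "i \<noteq> j" for i j
    using h that by (auto simp: bij_betw_def n_def inj_on_def)
  have inj: "inj_on y {..n}"
  proof (rule inj_onI)
    fix i j assume ij: "i \<in> {..n}" "j \<in> {..n}" "y i = y j"
    show "i = j"
    proof (rule ccontr)
      assume "i \<noteq> j"
      with ij consider "i < n" "j < n" | "i < n" "j = n" | "i = n" "j < n" by fastforce
      then show False
      proof cases
        case 1
        then show False
          using independent_mod1_imp_not_Ints_diff[OF assms(2,1), of "h i" "h j"] hI hinj \<open>i \<noteq> j\<close> ij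
          by (simp add: y_def)
      next
        case 2
        then show False
          using independent_mod1_imp_not_Ints[OF assms(2,1), of "h i"] hI ij
          by (simp add: y_def)
      next
        case 3
        then show False
          using independent_mod1_imp_not_Ints[OF assms(2,1), of "h j"] hI ij
          by (auto simp: y_def dest: sym)
      qed
    qed
  qed
  have "independent (y ` {..n})"
    unfolding independent_explicit_module
  proof (intro allI impI)
    fix t u v
    assume t: "finite t" "t \<subseteq> y ` {..n}" "(\<Sum>v\<in>t. real_of_int (u v) * v) = 0" "v \<in> t"
    \<comment> \<open>Extending the coefficients by zero lets the relation run over the whole
      family.\<close>
    define w where "w = (\<lambda>v. if v \<in> t then u v else 0)"
    have "(\<Sum>v\<in>t. real_of_int (u v) * v) = (\<Sum>v\<in>y ` {..n}. real_of_int (w v) * v)"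
      by (rule sum.mono_neutral_cong_left) (use t in \<open>auto simp: w_def\<close>)
    also have "\<dots> = (\<Sum>i\<le>n. real_of_int (w (y i)) * y i)"
      using inj by (simp add: sum.reindex)
    also have "\<dots> = (\<Sum>i<n. real_of_int (w (x (h i))) * x (h i)) + w 1"
      by (simp add: lessThan_Suc_atMost[symmetric] y_def)
    also have "(\<Sum>i<n. real_of_int (w (x (h i))) * x (h i)) = (\<Sum>i\<in>I. real_of_int (w (x i)) * x i)"
      using sum.reindex_bij_betw[OF h] unfolding n_def by fastforce
    \<comment> \<open>The adjoined 1 contributes an integer, so what remains is a relation modulo 1
      among the \<open>x i\<close>: their coefficients vanish, and then so does
      \<open>w 1\<close>.\<close>
    finally have eq: "(\<Sum>i\<in>I. real_of_int (w (x i)) * x i) = - of_int (w 1)"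
      using t by simp
    then have z: "w (x i) = 0" if "i \<in> I" for i
      using that by (intro independent_mod1D[OF assms(2), of "\<lambda>i. w (x i)"]) auto
    with eq have "w 1 = 0" by simp
    moreover obtain i where "i \<le> n" "v = y i" using t by auto
    ultimately have "w v = 0" using z hI by (auto simp: y_def)
    then show "u v = 0" using t by (simp add: w_def)
  qed
  moreover have "y n = 1" by (simp add: y_def)
  ultimately obtain k m where km: "\<And>i. i < n \<Longrightarrow> \<bar>of_int k * y i - of_int (m i) - b (h i)\<bar> < \<epsilon>"
    using Kronecker_thm_2[of y n \<epsilon> "\<lambda>i. b (h i)"] inj assms(3) by blast
  show thesis
  proof (rule that)
    fix i assume "i \<in> I"
    then obtain l where "l < n" "i = h l" using h by (auto simp: bij_betw_def n_def)
    with km[of l] show "infdist (of_int k * x i - b i) \<int> < \<epsilon>"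
      unfolding infdist_Ints_less_iff by (intro exI[of _ "m l"]) (simp add: y_def algebra_simps)
  qed
qed

text \<open>Dirichlet's simultaneous approximation. Its return times serve to shift the integer from
  Kronecker's theorem into the naturals.\<close>

lemma simultaneous_return_nat:
  fixes x :: "'i \<Rightarrow> real"
  assumes "finite I" "\<epsilon> > 0"
  obtains q :: nat where "q > 0" "\<And>i. i \<in> I \<Longrightarrow> infdist (of_nat q * x i) \<int> < \<epsilon>"
proof -
  obtain h where h: "bij_betw h {..<card I} I"
    using ex_bij_betw_nat_finite[OF assms(1)] by (auto simp: atLeast0LessThan)
  obtain N :: nat where N: "N > 0" "1 / N < \<epsilon>"
    using assms(2) by (metis nat_approx_posE inverse_eq_divide zero_less_Suc)
  obtain q p where qp: "0 < q" "\<And>i. i < card I \<Longrightarrow> \<bar>of_int q * x (h i) - of_int (p i)\<bar> < 1 / N"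
    by (rule Dirichlet_approx_simult[OF N(1), of "card I" "\<lambda>i. x (h i)"]) blast
  show thesis
  proof (rule that)
    show "nat q > 0" using qp by simp
    fix i assume "i \<in> I"
    then obtain l where "l < card I" "i = h l" using h by (auto simp: bij_betw_def)
    with qp(1) qp(2)[of l] N show "infdist (of_nat (nat q) * x i) \<int> < \<epsilon>"
      unfolding infdist_Ints_less_iff by (intro exI[of _ "p l"]) simp
  qed
qed

text \<open>Adding \<open>s\<close> copies of a return time \<open>q\<close> to \<open>k\<close>
  moves each point by less than \<open>s * (\<epsilon> / (2 * s))\<close>, that is
  \<open>\<epsilon> / 2\<close>, and for large \<open>s\<close> it lifts \<open>k\<close> above
  \<open>M\<close>.\<close>

lemma Kronecker_nat:
  fixes M :: nat
  assumes "finite I" "independent_mod1 I x" "\<epsilon> > 0"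
  obtains m :: nat where "m \<ge> M" "\<And>i. i \<in> I \<Longrightarrow> infdist (of_nat m * x i - b i) \<int> < \<epsilon>"
proof -
  obtain k :: int where k: "\<And>i. i \<in> I \<Longrightarrow> infdist (of_int k * x i - b i) \<int> < \<epsilon> / 2"
    using Kronecker_int[OF assms(1,2), of "\<epsilon> / 2" b] assms(3) by auto
  \<comment> \<open>Since \<open>q\<close> is at least 1, this makes \<open>k + q * s\<close> at
    least \<open>M\<close>; the final 1 keeps \<open>s\<close> positive for the division.\<close>
  define s where "s = nat \<bar>k\<bar> + M + 1"
  obtain q :: nat where q: "q > 0" "\<And>i. i \<in> I \<Longrightarrow> infdist (of_nat q * x i) \<int> < \<epsilon> / (2 * s)"
    using simultaneous_return_nat[OF assms(1), of "\<epsilon> / (2 * s)" x] assms(3)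
    by (auto simp: s_def)
  have "1 * s \<le> q * s" using q(1) by (intro mult_le_mono) auto
  then have "int s \<le> int (q * s)" by (simp only: of_nat_le_iff mult_1)
  moreover have "int s = \<bar>k\<bar> + int M + 1" by (simp add: s_def)
  ultimately have ge: "k + int (q * s) \<ge> int M" by linarith
  show thesis
  proof (rule that)
    show "nat (k + int (q * s)) \<ge> M" using ge by linarith
    fix i assume "i \<in> I"
    then obtain z w :: int where zw: "\<bar>of_int k * x i - b i - of_int z\<bar> < \<epsilon> / 2"
      "\<bar>of_nat q * x i - of_int w\<bar> < \<epsilon> / (2 * s)"
      using k q(2) unfolding infdist_Ints_less_iff by blast
    have "s > 0" by (simp add: s_def)
    have "\<bar>of_nat s * (of_nat q * x i - of_int w)\<bar> = of_nat s * \<bar>of_nat q * x i - of_int w\<bar>"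
      by (simp add: abs_mult)
    also have "\<dots> < of_nat s * (\<epsilon> / (2 * s))"
      using zw(2) \<open>s > 0\<close> by (intro mult_strict_left_mono) auto
    also have "\<dots> = \<epsilon> / 2" using \<open>s > 0\<close> by simp
    finally have "\<bar>of_nat s * (of_nat q * x i - of_int w)\<bar> < \<epsilon> / 2" .
    moreover have "real (nat (k + int (q * s))) = of_int k + of_nat q * of_nat s"
      using ge by (simp add: of_nat_nat)
    then have "real (nat (k + int (q * s))) * x i - b i - of_int (z + int s * w) =
        (of_int k * x i - b i - of_int z) + of_nat s * (of_nat q * x i - of_int w)"
      by (simp add: algebra_simps)
    ultimately have "\<bar>real (nat (k + int (q * s))) * x i - b i - of_int (z + int s * w)\<bar> < \<epsilon>"
      using zw(1) by linarith
    then show "infdist (of_nat (nat (k + int (q * s))) * x i - b i) \<int> < \<epsilon>"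
      unfolding infdist_Ints_less_iff by blast
  qed
qed

text \<open>Look for a time \<open>c + q * m\<close>: this asks that \<open>m\<close> times
  \<open>q * x i\<close> be close to \<open>- c * x i\<close>, a case of Kronecker's theorem for the
  scaled family.\<close>

lemma simultaneous_return_residue:
  fixes M q c :: nat
  assumes "finite I" "independent_mod1 I x" "\<epsilon> > 0" "q > 0"
  obtains m :: nat where "m \<ge> M" "m mod q = c mod q" "\<And>i. i \<in> I \<Longrightarrow> infdist (of_nat m * x i) \<int> < \<epsilon>"
proof -
  obtain m :: nat where m: "m \<ge> M"
    "\<And>i. i \<in> I \<Longrightarrow> infdist (of_nat m * (of_int (int q) * x i) - (- of_nat c * x i)) \<int> < \<epsilon>"
    using Kronecker_nat[OF assms(1) independent_mod1_scale[OF assms(2), of "int q"] assms(3),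
        of M "\<lambda>i. - of_nat c * x i"] assms(4) by auto
  show thesis
  proof (rule that)
    have "1 * m \<le> q * m" using assms(4) by (intro mult_le_mono) auto
    then show "c + q * m \<ge> M" using m(1) by linarith
    show "(c + q * m) mod q = c mod q" by simp
    show "infdist (of_nat (c + q * m) * x i) \<int> < \<epsilon>" if "i \<in> I" for i
      using m(2)[OF that] by (simp add: algebra_simps)
  qed
qed

text \<open>This is why one index has to be given up in the statement: an irrational that is a rational
  combination of the \<open>x i\<close> depends on some \<open>x j\<close> and can take its place.\<close>

lemma independent_mod1_exchange:
  fixes \<theta> :: real
  assumes "finite I" "I \<noteq> {}" "independent_mod1 I x" "\<theta> \<notin> \<rat>"
  obtains j where "j \<in> I" "independent_mod1 I (x(j := \<theta>))"
proof (rule ccontr)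
  assume "\<not> thesis"
  \<comment> \<open>The coefficient of \<open>\<theta>\<close> is nonzero, for otherwise the
    relation would involve the \<open>x i\<close> alone.\<close>
  have dep: "\<exists>c :: 'a \<Rightarrow> int. of_int (c j) * \<theta> + (\<Sum>i\<in>I - {j}. of_int (c i) * x i) \<in> \<int> \<and> c j \<noteq> 0"
    if "j \<in> I" for j
  proof -
    have "\<not> independent_mod1 I (x(j := \<theta>))"
      using that \<open>\<not> thesis\<close> \<open>\<And>j. j \<in> I \<Longrightarrow> independent_mod1 I (x(j := \<theta>)) \<Longrightarrow> thesis\<close> by blast
    then obtain c l where c: "(\<Sum>i\<in>I. of_int (c i) * (x(j := \<theta>)) i) \<in> \<int>" "l \<in> I" "c l \<noteq> (0 :: int)"
      unfolding independent_mod1_def by blast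
    have "(\<Sum>i\<in>I. of_int (c i) * (x(j := \<theta>)) i) =
        of_int (c j) * \<theta> + (\<Sum>i\<in>I - {j}. of_int (c i) * x i)"
      using assms(1) that by (simp add: sum.remove)
    moreover have False if "c j = 0"
    proof -
      have "(\<Sum>i\<in>I. of_int (c i) * x i) = (\<Sum>i\<in>I. of_int (c i) * (x(j := \<theta>)) i)"
        using that by (intro sum.cong) auto
      then show False using c independent_mod1D[OF assms(3), of c l] by simp
    qed
    ultimately show ?thesis using c(1) by metis
  qed
  obtain l where l: "l \<in> I" using assms(2) by blast
  obtain c where c: "of_int (c l) * \<theta> + (\<Sum>i\<in>I - {l}. of_int (c i) * x i) \<in> \<int>" "c l \<noteq> (0 :: int)"
    using dep[OF l] by blast
  \<comment> \<open>If \<open>\<theta>\<close> were alone in the relation, it would be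
    rational.\<close>
  have "\<exists>j\<in>I - {l}. c j \<noteq> 0"
  proof (rule ccontr)
    assume "\<not> (\<exists>j\<in>I - {l}. c j \<noteq> 0)"
    with c have "of_int (c l) * \<theta> \<in> \<int>" by simp
    then have "of_int (c l) * \<theta> \<in> \<rat>" using Ints_subset_Rats by blast
    then have "of_int (c l) * \<theta> / of_int (c l) \<in> \<rat>" by (intro Rats_divide) auto
    with c(2) assms(4) show False by simp
  qed
  then obtain j where j: "j \<in> I" "j \<noteq> l" "c j \<noteq> 0" by blast
  obtain d where d: "of_int (d j) * \<theta> + (\<Sum>i\<in>I - {j}. of_int (d i) * x i) \<in> \<int>" "d j \<noteq> (0 :: int)"
    using dep[OF j(1)] by blast
  \<comment> \<open>The combination of the two relations that eliminates \<open>\<theta>\<close>.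
    Its coefficient at \<open>j\<close> is \<open>d j * c j\<close>, because \<open>j\<close>
    differs from \<open>l\<close> and the entry of \<open>d\<close> at \<open>j\<close> is
    cleared.\<close>
  define e where "e = (\<lambda>i. d j * (c(l := 0)) i - c l * (d(j := 0)) i)"
  have drop: "(\<Sum>i\<in>I. of_int ((f(a := 0)) i) * x i) = (\<Sum>i\<in>I - {a}. of_int (f i) * x i)"
    if "a \<in> I" for a and f :: "'a \<Rightarrow> int"
    using assms(1) that by (simp add: sum.remove[of I a])
  have "(\<Sum>i\<in>I. of_int (e i) * x i) =
      of_int (d j) * (\<Sum>i\<in>I. of_int ((c(l := 0)) i) * x i) - of_int (c l) * (\<Sum>i\<in>I. of_int ((d(j := 0)) i) * x i)"
    unfolding e_def sum_distrib_left sum_subtractf[symmetric]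
    by (intro sum.cong) (simp_all add: algebra_simps)
  also have "\<dots> = of_int (d j) * (of_int (c l) * \<theta> + (\<Sum>i\<in>I - {l}. of_int (c i) * x i))
      - of_int (c l) * (of_int (d j) * \<theta> + (\<Sum>i\<in>I - {j}. of_int (d i) * x i))"
    unfolding drop[OF l] drop[OF j(1)] by (simp add: algebra_simps)
  also have "\<dots> \<in> \<int>"
    using c(1) d(1) by (intro Ints_diff Ints_mult Ints_of_int)
  finally have "e j = 0"
    using independent_mod1D[OF assms(3)] j(1) by blast
  then show False using j d(2) by (simp add: e_def)
qed

section \<open>Multipliers that nearly fix all but one point, and the rotations they act on
  densely\<close>

text \<open>A \<open>j\<close> outside \<open>{1..k}\<close> is allowed and means that no index is
  exempt. One parameter governs both the number of indices and the tolerance.\<close>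

definition almost_returns :: "(nat \<Rightarrow> real) \<Rightarrow> nat \<Rightarrow> nat set"
  where "almost_returns x k =
    {m. m \<ge> 1 \<and> (\<exists>j. \<forall>i\<in>{1..k} - {j}. infdist (of_nat m * x i) \<int> < 1 / k)}"

definition small_rationals :: "nat \<Rightarrow> real set"
  where "small_rationals k = {of_int p / of_nat q |p q. q \<in> {1..k}}"

text \<open>An irrational \<open>\<theta>\<close> replaces some \<open>x j\<close>, and Kronecker's
  theorem is applied with target \<open>\<beta>\<close> at \<open>j\<close> and 0 elsewhere. For
  \<open>\<theta> = a / q\<close> in lowest terms the multiples form the grid of step
  \<open>1 / q\<close>, finer than \<open>1 / k\<close>, and a residue of \<open>m\<close> modulo
  \<open>q\<close> selects the grid point.\<close>

lemma almost_returns_dense_rotation: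
  assumes "k \<ge> 1" "independent_mod1 {1..k} x" "\<theta> \<notin> small_rationals k"
  obtains m where "m \<in> almost_returns x k" "infdist (of_nat m * \<theta> - \<beta>) \<int> < 1 / k"
proof (cases "\<theta> \<in> \<rat>")
  case False
  then obtain j where j: "j \<in> {1..k}" "independent_mod1 {1..k} (x(j := \<theta>))"
    using independent_mod1_exchange[of "{1..k}" x \<theta>] assms by auto
  obtain m :: nat where m: "m \<ge> 1"
    "\<And>i. i \<in> {1..k} \<Longrightarrow> infdist (of_nat m * (x(j := \<theta>)) i - ((\<lambda>_. 0)(j := \<beta>)) i) \<int> < 1 / k"
    using Kronecker_nat[OF _ j(2), of "1 / k" 1 "(\<lambda>_. 0)(j := \<beta>)"] assms(1) by auto
  show thesis
  proof (rule that)
    have "infdist (of_nat m * x i) \<int> < 1 / k" if "i \<in> {1..k} - {j}" for i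
      using m(2)[of i] that by simp
    then show "m \<in> almost_returns x k"
      unfolding almost_returns_def using m(1) by blast
    show "infdist (of_nat m * \<theta> - \<beta>) \<int> < 1 / k"
      using m(2)[OF j(1)] by simp
  qed
next
  case True
  obtain r where r: "\<theta> = of_rat r" using True by (auto elim: Rats_cases)
  obtain a q where q: "quotient_of r = (a, q)" by fastforce
  then have q0: "q > 0" and cop: "coprime a q" by (simp_all add: quotient_of_denom_pos quotient_of_coprime)
  have th: "\<theta> = of_int a / of_int q"
    using r quotient_of_div[OF q] by (simp add: of_rat_divide)
  have qk: "q > int k"
  proof (rule ccontr)
    assume "\<not> q > int k"
    then have "nat q \<in> {1..k}" using q0 by auto
    moreover have "\<theta> = of_int a / of_nat (nat q)" using th q0 by simp
    ultimately show False using assms(3) unfolding small_rationals_def by blast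
  qed
  \<comment> \<open>\<open>b / q\<close> is the last grid point not exceeding
    \<open>\<beta>\<close>; as \<open>a\<close> is invertible modulo \<open>q\<close>, some multiple
    of \<open>\<theta>\<close> hits it modulo 1.\<close>
  define b where "b = \<lfloor>of_int q * \<beta>\<rfloor>"
  obtain c0 where c0: "[a * c0 = b] (mod q)"
    using cop by (metis cong_solve_coprime_int cong_scalar_right mult.assoc mult_1)
  define c where "c = nat (c0 mod q)"
  have c: "[a * int c = b] (mod q)"
    using c0 q0 unfolding c_def by (simp add: cong_def mod_mult_right_eq)
  obtain m :: nat where m: "m \<ge> 1" "m mod nat q = c mod nat q"
    "\<And>i. i \<in> {1..k} \<Longrightarrow> infdist (of_nat m * x i) \<int> < 1 / k"
    using simultaneous_return_residue[OF _ assms(2), of "1 / k" "nat q" 1 c] assms(1) q0 by auto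
  have "int m mod q = int c mod q"
    using m(2) q0 by (metis int_nat_eq less_le zmod_int)
  then have "[a * int m = a * int c] (mod q)"
    by (metis cong_def cong_scalar_left)
  then have "[a * int m = b] (mod q)" using c by (rule cong_trans)
  then obtain z where z: "a * int m = b + q * z"
    by (metis cong_iff_lin cong_sym mult.commute)
  have "of_nat m * \<theta> = of_int (a * int m) / of_int q"
    by (simp add: th)
  also have "\<dots> = of_int b / of_int q + of_int z"
    unfolding z using q0 by (simp add: field_simps)
  finally have eq: "of_nat m * \<theta> - \<beta> - of_int z = - ((of_int q * \<beta> - of_int b) / of_int q)"
    using q0 by (simp add: field_simps)
  have "\<bar>(of_int q * \<beta> - of_int b) / of_int q\<bar> \<le> 1 / of_int q"
    unfolding abs_divide using q0 by (intro frac_le) (auto simp: b_def, linarith)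
  also have "\<dots> < 1 / k"
    using qk assms(1) by (intro divide_strict_left_mono) auto
  finally have "\<bar>of_nat m * \<theta> - \<beta> - of_int z\<bar> < 1 / k"
    unfolding eq by simp
  then have "infdist (of_nat m * \<theta> - \<beta>) \<int> < 1 / k"
    unfolding infdist_Ints_less_iff by blast
  moreover have "m \<in> almost_returns x k"
    unfolding almost_returns_def using m by blast
  ultimately show thesis using that by blast
qed

text \<open>The radius is half of \<open>1 / (k * (k + 1))\<close>, a lower bound for the gap
  between distinct fractions with denominators up to \<open>k\<close> and up to
  \<open>k + 1\<close>.\<close>

definition near_small_rationals :: "nat \<Rightarrow> real set"
  where "near_small_rationals k = (\<Union>r\<in>small_rationals k. ball r (1 / (2 * (k * (k + 1)))))"

text \<open>Compactness is used on pairs of a rotation and a target, so that a single finite set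
  serves all targets at once.\<close>

lemma finite_stage:
  assumes "k \<ge> 1" "independent_mod1 {1..k} x"
  obtains F where "finite F" "F \<subseteq> almost_returns x k"
    "\<exists>m\<in>F. m > k \<and> (\<forall>d\<in>{2..k}. \<not> d dvd m)"
    "\<And>\<theta> \<beta>. \<theta> \<in> {0..1} - near_small_rationals k \<Longrightarrow> \<beta> \<in> {0..1} \<Longrightarrow>
       \<exists>m\<in>F. infdist (of_nat m * \<theta> - \<beta>) \<int> < 1 / k"
proof -
  have op: "open (near_small_rationals k)"
    unfolding near_small_rationals_def by blast
  have sub: "small_rationals k \<subseteq> near_small_rationals k"
    unfolding near_small_rationals_def using assms(1) by fastforce
  define U where "U = (\<lambda>m :: nat. {p. infdist (of_nat m * fst p - snd p) \<int> < 1 / k} :: (real \<times> real) set)"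
  have "compact (({0..1} - near_small_rationals k) \<times> {0..1 :: real})"
    using op by (intro compact_Times compact_diff) auto
  moreover have "open (U m)" for m
    unfolding U_def by (intro open_Collect_less continuous_intros)
  moreover have "({0..1} - near_small_rationals k) \<times> {0..1} \<subseteq> (\<Union>m\<in>almost_returns x k. U m)"
  proof
    fix p assume "p \<in> ({0..1} - near_small_rationals k) \<times> {0..1 :: real}"
    then have "fst p \<notin> small_rationals k" using sub by auto
    then obtain m where "m \<in> almost_returns x k" "infdist (of_nat m * fst p - snd p) \<int> < 1 / k"
      using almost_returns_dense_rotation[OF assms] by blast
    then show "p \<in> (\<Union>m\<in>almost_returns x k. U m)" by (auto simp: U_def)
  qed
  ultimately obtain F where F: "F \<subseteq> almost_returns x k" "finite F"
    "({0..1} - near_small_rationals k) \<times> {0..1} \<subseteq> (\<Union>m\<in>F. U m)"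
    by (rule compactE_image)
  \<comment> \<open>Residue 1 modulo \<open>k!\<close> rules out every divisor from 2 to
    \<open>k\<close>. It is written \<open>1 mod fact k\<close> because it is 0 for
    \<open>k = 1\<close>. The bound \<open>k + 1\<close> makes these elements unbounded over the
    stages.\<close>
  obtain m :: nat where m: "m \<ge> k + 1" "m mod fact k = 1 mod fact k"
    "\<And>i. i \<in> {1..k} \<Longrightarrow> infdist (of_nat m * x i) \<int> < 1 / k"
    using simultaneous_return_residue[OF _ assms(2), of "1 / k" "fact k" "k + 1" 1] assms(1) by auto
  have mr: "m \<in> almost_returns x k"
    unfolding almost_returns_def using m by auto
  have nd: "\<not> d dvd m" if "d \<in> {2..k}" for d
  proof
    assume "d dvd m"
    moreover have "d dvd fact k" using that by (intro dvd_fact) auto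
    ultimately have "d dvd m mod fact k" by (simp add: dvd_mod)
    then have "d dvd 1 mod fact k" unfolding m(2) .
    then have "d dvd 1" using dvd_mod_iff[OF \<open>d dvd fact k\<close>] by blast
    with that show False by simp
  qed
  show thesis
  proof (rule that)
    show "finite (insert m F)" "insert m F \<subseteq> almost_returns x k"
      using F mr by auto
    show "\<exists>m\<in>insert m F. m > k \<and> (\<forall>d\<in>{2..k}. \<not> d dvd m)"
      using m(1) nd by auto
    show "\<exists>m\<in>insert m F. infdist (of_nat m * \<theta> - \<beta>) \<int> < 1 / k"
      if "\<theta> \<in> {0..1} - near_small_rationals k" "\<beta> \<in> {0..1}" for \<theta> \<beta>
    proof -
      have "(\<theta>, \<beta>) \<in> (\<Union>m\<in>F. U m)" using F(3) that by blast
      then show ?thesis by (auto simp: U_def)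
    qed
  qed
qed

section \<open>Irrationals escape the neighbourhoods of small rationals\<close>

text \<open>Over the common denominator \<open>p * q\<close>, at most \<open>k * (k + 1)\<close>,
  the difference has a nonzero integer numerator.\<close>

lemma small_rationals_dist:
  assumes "r \<in> small_rationals k" "s \<in> small_rationals (k + 1)" "r \<noteq> s"
  shows "1 / (k * (k + 1)) \<le> \<bar>r - s\<bar>"
proof -
  obtain a p where r: "r = of_int a / of_nat p" "p \<in> {1..k}"
    using assms(1) unfolding small_rationals_def by blast
  obtain b q where s: "s = of_int b / of_nat q" "q \<in> {1..k + 1}"
    using assms(2) unfolding small_rationals_def by blast
  have "p > 0" "q > 0" using r s by auto
  then have eq: "r - s = of_int (a * int q - b * int p) / of_nat (p * q)"
    unfolding r(1) s(1) by (simp add: field_simps)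
  have "a * int q - b * int p \<noteq> 0"
    using assms(3) eq by (metis div_0 of_int_0 right_minus_eq)
  then have "1 \<le> \<bar>a * int q - b * int p\<bar>" by linarith
  then have ge1: "1 \<le> \<bar>real_of_int (a * int q - b * int p)\<bar>"
    by (metis of_int_1_le_iff of_int_abs)
  have "p * q \<le> k * (k + 1)" using r s by (intro mult_le_mono) auto
  moreover have "p * q > 0" using r s by auto
  ultimately have "1 / real (k * (k + 1)) \<le> 1 / of_nat (p * q)"
    by (intro frac_le) (simp_all only: of_nat_le_iff of_nat_0_less_iff zero_le_one order_refl)
  also have "\<dots> \<le> \<bar>real_of_int (a * int q - b * int p)\<bar> / of_nat (p * q)"
    using ge1 by (intro divide_right_mono) auto
  also have "\<dots> = \<bar>r - s\<bar>" unfolding eq by (simp add: abs_divide)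
  finally show ?thesis by simp
qed

text \<open>Rationals approximating \<open>\<theta>\<close> at consecutive stages are too close to be distinct, so
  a number that is near small rationals from some stage on is itself rational.\<close>

lemma irrational_escapes_infinitely_often:
  assumes "\<theta> \<notin> \<rat>"
  obtains k where "k \<ge> K" "\<theta> \<notin> near_small_rationals k"
proof (rule ccontr)
  assume neg: "\<not> thesis"
  define \<eta> :: "nat \<Rightarrow> real" where "\<eta> = (\<lambda>k. 1 / (2 * (k * (k + 1))))"
  have "\<exists>r\<in>small_rationals k. \<bar>\<theta> - r\<bar> < \<eta> k" if "k \<ge> K" for k
  proof -
    have "\<theta> \<in> near_small_rationals k" using neg that \<open>\<And>k. K \<le> k \<Longrightarrow> \<theta> \<notin> near_small_rationals k \<Longrightarrow> thesis\<close> by blast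
    then show ?thesis
      unfolding near_small_rationals_def \<eta>_def by (auto simp: dist_real_def abs_minus_commute)
  qed
  then obtain r where r: "\<And>k. k \<ge> K \<Longrightarrow> r k \<in> small_rationals k" "\<And>k. k \<ge> K \<Longrightarrow> \<bar>\<theta> - r k\<bar> < \<eta> k"
    by metis
  \<comment> \<open>Starting above \<open>K\<close> excludes \<open>k = 0\<close>, where division by
    zero gives \<open>\<eta> 0 = 0\<close> and \<open>\<eta>\<close> fails to decrease.\<close>
  define L where "L = K + 1"
  have step: "r (Suc k) = r k" if "k \<ge> L" for k
  proof (rule ccontr)
    assume "r (Suc k) \<noteq> r k"
    then have "1 / (k * (k + 1)) \<le> \<bar>r k - r (Suc k)\<bar>"
      using r(1)[of k] r(1)[of "Suc k"] that by (intro small_rationals_dist) (auto simp: L_def)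
    also have "\<dots> < \<eta> k + \<eta> (Suc k)"
      using r(2)[of k] r(2)[of "Suc k"] that by (simp add: L_def)
    also have "\<dots> \<le> \<eta> k + \<eta> k"
    proof -
      have "k > 0" using that by (simp add: L_def)
      then have "\<eta> (Suc k) \<le> \<eta> k"
        unfolding \<eta>_def by (intro divide_left_mono mult_left_mono) (auto intro!: mult_mono)
      then show ?thesis by simp
    qed
    also have "\<dots> = 1 / (k * (k + 1))"
    proof -
      have "1 / (2 * c) + 1 / (2 * c) = 1 / c" for c :: real by (simp add: field_simps)
      then show ?thesis unfolding \<eta>_def by (simp only: of_nat_mult of_nat_add of_nat_1)
    qed
    finally show False by simp
  qed
  have const: "r k = r L" if "k \<ge> L" for k
    using that by (induction k rule: dec_induct) (auto simp: step)
  \<comment> \<open>The approximants are now constant while the radii shrink to 0, so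
    \<open>\<theta>\<close> equals that constant.\<close>
  have "\<eta> \<longlonglongrightarrow> 0"
  proof (rule tendsto_sandwich)
    show "\<forall>\<^sub>F k in sequentially. 0 \<le> \<eta> k" by (simp add: \<eta>_def)
    show "\<forall>\<^sub>F k in sequentially. \<eta> k \<le> 1 / real k"
    proof (rule eventually_sequentiallyI[of 1])
      fix k :: nat assume "k \<ge> 1"
      then have "real k * 1 \<le> 2 * (real k * (real k + 1))"
        by (simp add: algebra_simps)
      with \<open>k \<ge> 1\<close> show "\<eta> k \<le> 1 / real k"
        unfolding \<eta>_def by (intro frac_le) (auto simp: algebra_simps)
    qed
    show "(\<lambda>k. 1 / real k) \<longlonglongrightarrow> 0" by (rule lim_1_over_n)
  qed auto
  moreover have "\<bar>\<theta> - r L\<bar> \<le> \<eta> k" if "k \<ge> L" for k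
    using r(2)[of k] const[OF that] that by (simp add: L_def)
  ultimately have "\<bar>\<theta> - r L\<bar> \<le> 0"
    by (intro tendsto_lowerbound[of \<eta> 0 sequentially]) (auto simp: eventually_sequentially)
  then have "\<theta> = r L" by simp
  moreover have "r L \<in> \<rat>" using r(1)[of L] by (auto simp: L_def small_rationals_def)
  ultimately show False using assms by simp
qed

section \<open>Transfer between the circle and the real line\<close>

text \<open>In the quotient topology the complement of the closure pulls back to an open set of
  reals invariant under integer shifts. If it is nonempty, it contains a ball around a point of the
  unit interval, and an integer translate of some point of \<open>Y\<close> falls into that
  ball.\<close>

lemma closure_circle_eq_UNIV:
  assumes "\<And>\<beta> \<epsilon>. \<beta> \<in> {0..1} \<Longrightarrow> \<epsilon> > 0 \<Longrightarrow> \<exists>y\<in>Y. infdist (y - \<beta>) \<int> < \<epsilon>"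
  shows "closure (circle_of ` Y) = UNIV"
proof -
  have "c \<in> closure (circle_of ` Y)" for c
  proof (rule ccontr)
    assume notin: "c \<notin> closure (circle_of ` Y)"
    define V where "V = circle_of -` (- closure (circle_of ` Y))"
    have "open V"
      unfolding V_def using open_circle_def closed_closure by (metis open_Compl)
    obtain \<beta>' where \<beta>': "c = circle_of \<beta>'"
      by (metis Quotient3_abs_rep Quotient3_circle circle_of.abs_eq)
    define \<beta> where "\<beta> = frac \<beta>'"
    have \<beta>: "c = circle_of \<beta>" by (simp add: \<beta>_def \<beta>' circle_of_frac)
    then have "\<beta> \<in> V" using notin by (simp add: V_def)
    then obtain \<epsilon> where e: "\<epsilon> > 0" "ball \<beta> \<epsilon> \<subseteq> V"
      using \<open>open V\<close> open_contains_ball by blast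
    have "\<beta> \<in> {0..1}" by (simp add: \<beta>_def less_imp_le frac_lt_1)
    then obtain y where y: "y \<in> Y" "infdist (y - \<beta>) \<int> < \<epsilon>" using assms e by blast
    then obtain z :: int where "\<bar>y - \<beta> - of_int z\<bar> < \<epsilon>" unfolding infdist_Ints_less_iff by blast
    then have "y - of_int z \<in> V" using e(2) by (force simp: dist_real_def)
    moreover have "circle_of (y - of_int z) = circle_of y" by (simp add: circle_of_eq_iff)
    ultimately have "circle_of y \<notin> closure (circle_of ` Y)" by (simp add: V_def)
    then show False using y(1) closure_subset by blast
  qed
  then show ?thesis by blast
qed

lemma circle_norm_scale: "circle_norm (circle_scale k (circle_of x)) = infdist (of_int k * x) \<int>"
  by transfer simp

lemma sum_circle_scale:
  "(\<Sum>i\<in>I. circle_scale (c i) (circle_of (x i))) = circle_of (\<Sum>i\<in>I. of_int (c i) * x i)"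
proof (induction I rule: infinite_finite_induct)
  case (insert i I)
  have "circle_scale (c i) (circle_of (x i)) + circle_of s = circle_of (of_int (c i) * x i + s)" for s
    by transfer simp
  with insert show ?case by simp
qed (simp_all, (transfer, simp)+)

lemma rationally_independent_imp_independent_mod1:
  assumes "rationally_independent (\<lambda>i. circle_of (x i))"
  shows "independent_mod1 {1..k} x"
  unfolding independent_mod1_def
proof (intro allI impI)
  fix c :: "nat \<Rightarrow> int"
  assume *: "(\<Sum>i = 1..k. of_int (c i) * x i) \<in> \<int>"
  have "(\<Sum>i = 1..k. circle_scale (c i) (circle_of (x i))) = circle_of 0"
    unfolding sum_circle_scale circle_of_eq_iff using * by simp
  also have "\<dots> = 0" by transfer simp
  finally have "(\<Sum>i = 1..k. circle_scale (c i) (circle_of (x i))) = 0" .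
  then show "\<forall>i\<in>{1..k}. c i = 0"
    using assms unfolding rationally_independent_def by blast
qed

section \<open>Assembling the stages into one sequence\<close>

theorem theorem1:
  fixes \<alpha> :: "nat \<Rightarrow> circle"
  assumes "rationally_independent \<alpha>"
  shows "\<exists>m :: nat \<Rightarrow> nat.
    strict_mono_on {1..} m \<and> (\<forall>n \<ge> 1. m n \<ge> 1) \<and>
    (\<forall>\<theta> :: real. \<theta> \<notin> \<rat> \<longrightarrow>
       closure ((\<lambda>n. circle_of (real (m n) * \<theta>)) ` {1..}) = UNIV) \<and>
    (\<forall>\<epsilon> :: real. \<forall>k :: nat. \<epsilon> > 0 \<longrightarrow> k \<ge> 1 \<longrightarrow>
       (\<exists>N0 \<ge> 1. \<forall>n \<ge> N0.
          card {i \<in> {1..k}. circle_norm (circle_scale (int (m n)) (\<alpha> i)) < \<epsilon>} \<ge> k - 1)) \<and>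
    (\<forall>k :: nat. k \<ge> 2 \<longrightarrow> infinite {n. n \<ge> 1 \<and> \<not> k dvd m n})"
proof -
  have "\<forall>i. \<exists>y. \<alpha> i = circle_of y"
    by (metis Quotient3_abs_rep Quotient3_circle circle_of.abs_eq)
  then obtain x where x: "\<And>i. \<alpha> i = circle_of (x i)" by metis
  then have "\<alpha> = (\<lambda>i. circle_of (x i))" by auto
  then have ind: "independent_mod1 {1..k} x" for k
    using assms rationally_independent_imp_independent_mod1 by blast
  \<comment> \<open>One predicate for all properties, so that a single choice yields
    \<open>F\<close>.\<close>
  define stage where "stage = (\<lambda>k F. finite F \<and> F \<subseteq> almost_returns x k \<and> (\<exists>m\<in>F. m > k \<and> (\<forall>d\<in>{2..k}. \<not> d dvd m)) \<and>
    (\<forall>\<theta> \<beta>. \<theta> \<in> {0..1} - near_small_rationals k \<longrightarrow> \<beta> \<in> {0..1} \<longrightarrow>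
       (\<exists>m\<in>F. infdist (of_nat m * \<theta> - \<beta>) \<int> < 1 / k)))"
  have "\<exists>F. stage k F" if "k \<ge> 1" for k
  proof -
    obtain F where "finite F" "F \<subseteq> almost_returns x k"
      "\<exists>m\<in>F. m > k \<and> (\<forall>d\<in>{2..k}. \<not> d dvd m)"
      "\<And>\<theta> \<beta>. \<theta> \<in> {0..1} - near_small_rationals k \<Longrightarrow> \<beta> \<in> {0..1} \<Longrightarrow>
         \<exists>m\<in>F. infdist (of_nat m * \<theta> - \<beta>) \<int> < 1 / k"
      by (rule finite_stage[OF \<open>k \<ge> 1\<close> ind]) blast
    then show ?thesis unfolding stage_def by (intro exI[of _ F]) simp
  qed
  then obtain F where "\<And>k. k \<ge> 1 \<Longrightarrow> stage k (F k)" by metis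
  then have F: "\<And>k. k \<ge> 1 \<Longrightarrow> finite (F k)"
    "\<And>k. k \<ge> 1 \<Longrightarrow> F k \<subseteq> almost_returns x k"
    "\<And>k. k \<ge> 1 \<Longrightarrow> \<exists>m\<in>F k. m > k \<and> (\<forall>d\<in>{2..k}. \<not> d dvd m)"
    "\<And>k \<theta> \<beta>. k \<ge> 1 \<Longrightarrow> \<theta> \<in> {0..1} - near_small_rationals k \<Longrightarrow> \<beta> \<in> {0..1} \<Longrightarrow>
       \<exists>m\<in>F k. infdist (of_nat m * \<theta> - \<beta>) \<int> < 1 / k"
    unfolding stage_def by blast+
  define S where "S = (\<Union>k\<in>{1..}. F k)"
  \<comment> \<open>Stage \<open>max N d\<close> is late enough both to exceed \<open>N\<close> and
    to have \<open>d\<close> among the excluded divisors. This gives (c) and also that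
    \<open>S\<close> is infinite.\<close>
  have infd: "infinite {m\<in>S. \<not> d dvd m}" if "d \<ge> 2" for d
    unfolding infinite_nat_iff_unbounded
  proof
    fix N
    obtain m where "m \<in> F (max N d)" "m > max N d" "\<forall>e\<in>{2..max N d}. \<not> e dvd m"
      using F(3)[of "max N d"] \<open>d \<ge> 2\<close> by (metis le_max_iff_disj one_le_numeral order_trans)
    then show "\<exists>m>N. m \<in> {m\<in>S. \<not> d dvd m}"
      using \<open>d \<ge> 2\<close> by (intro exI[of _ m]) (auto simp: S_def intro!: bexI[of _ "max N d"])
  qed
  have inf: "infinite S" using infd[of 2] by (auto dest: finite_subset[rotated])
  \<comment> \<open>\<open>enumerate\<close> starts at 0, the sequence at 1.\<close>
  define m where "m = (\<lambda>n. enumerate S (n - 1))"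
  have mS: "m ` {1..} = S"
  proof -
    have "m ` {1..} = range (enumerate S)"
      unfolding m_def by (force simp: image_iff intro: bexI[of _ "Suc _"])
    then show ?thesis using range_enumerate[OF inf] by simp
  qed
  have mono: "strict_mono_on {1..} m"
    using enumerate_mono[OF _ inf] by (auto simp: m_def strict_mono_on_def)
  then have inj: "inj_on m {1..}" by (rule strict_mono_on_imp_inj_on)
  have pos: "s \<ge> 1" if "s \<in> S" for s
    using that F(2) by (auto simp: S_def almost_returns_def)
  have "\<forall>n\<ge>1. m n \<ge> 1" using mS pos by auto
  moreover have "closure ((\<lambda>n. circle_of (real (m n) * \<theta>)) ` {1..}) = UNIV" if "\<theta> \<notin> \<rat>" for \<theta>
  proof -
    \<comment> \<open>Density concerns only the set of values, so the enumeration may be replaced by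
      \<open>S\<close>.\<close>
    have "closure (circle_of ` (\<lambda>s. real s * \<theta>) ` S) = UNIV"
    proof (rule closure_circle_eq_UNIV)
      fix \<beta> \<epsilon> :: real assume \<beta>: "\<beta> \<in> {0..1}" and "\<epsilon> > 0"
      \<comment> \<open>The stages treat rotations in the unit interval only; passing to the
        fractional part changes \<open>s * \<theta>\<close> by an integer.\<close>
      have "frac \<theta> \<notin> \<rat>"
        using that by (metis Rats_add Rats_of_int add_diff_cancel_right' diff_add_cancel frac_def)
      obtain K :: nat where K: "K > 0" "1 / K < \<epsilon>"
        using \<open>\<epsilon> > 0\<close> by (metis nat_approx_posE inverse_eq_divide zero_less_Suc)
      obtain k where k: "k \<ge> K" "frac \<theta> \<notin> near_small_rationals k"
        using irrational_escapes_infinitely_often[OF \<open>frac \<theta> \<notin> \<rat>\<close>] by blast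
      have "frac \<theta> \<in> {0..1}" by (simp add: less_imp_le frac_lt_1)
      then obtain s where s: "s \<in> F k" "infdist (of_nat s * frac \<theta> - \<beta>) \<int> < 1 / k"
        using F(4)[of k "frac \<theta>" \<beta>] k K \<beta> by auto
      have "infdist (real s * \<theta> - \<beta>) \<int> = infdist (real s * frac \<theta> - \<beta>) \<int>"
        by (rule infdist_Ints_cong) (simp add: frac_def algebra_simps)
      also have "\<dots> < 1 / k" by (rule s)
      also have "\<dots> \<le> 1 / K" using K k by (intro divide_left_mono) auto
      also have "\<dots> < \<epsilon>" by (rule K)
      finally show "\<exists>y\<in>(\<lambda>s. real s * \<theta>) ` S. infdist (y - \<beta>) \<int> < \<epsilon>"
        using s(1) k K by (force simp: S_def)
    qed
    then show ?thesis by (simp add: mS[symmetric] image_image)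
  qed
  moreover have "\<exists>N0 \<ge> 1. \<forall>n \<ge> N0.
      card {i \<in> {1..k}. circle_norm (circle_scale (int (m n)) (\<alpha> i)) < \<epsilon>} \<ge> k - 1"
    if "\<epsilon> > 0" for \<epsilon> :: real and k :: nat
  proof -
    obtain K0 :: nat where K0: "K0 > 0" "1 / K0 < \<epsilon>"
      using \<open>\<epsilon> > 0\<close> by (metis nat_approx_posE inverse_eq_divide zero_less_Suc)
    \<comment> \<open>Beyond stage \<open>K\<close> all indices up to \<open>k\<close> are covered
      and the tolerance is below \<open>\<epsilon>\<close>.\<close>
    define K where "K = max K0 k"
    \<comment> \<open>The first \<open>K\<close> stages hold finitely many values, and
      \<open>m\<close> is injective, so every later term must come from a stage beyond
      \<open>K\<close>.\<close>
    have "finite (\<Union>l\<in>{1..K}. F l)" using F(1) by auto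
    then have "finite (m -` (\<Union>l\<in>{1..K}. F l) \<inter> {1..})"
      using inj by (rule finite_vimage_IntI)
    then have "finite {n\<in>{1..}. m n \<in> (\<Union>l\<in>{1..K}. F l)}"
      by (rule finite_subset[rotated]) auto
    then obtain N where N: "\<And>n. n \<in> {n\<in>{1..}. m n \<in> (\<Union>l\<in>{1..K}. F l)} \<Longrightarrow> n \<le> N"
      unfolding finite_nat_set_iff_bounded_le by blast
    show ?thesis
    proof (intro exI[of _ "N + 1"] conjI allI impI)
      fix n assume n: "N + 1 \<le> n"
      then have "m n \<in> S" using mS by auto
      then obtain l where l: "l \<ge> 1" "m n \<in> F l" by (auto simp: S_def)
      have "l > K"
      proof (rule ccontr)
        assume "\<not> l > K"
        with l n have "n \<le> N" by (intro N) auto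
        with n show False by simp
      qed
      have "m n \<in> almost_returns x l" using F(2) l by blast
      then obtain j where j: "\<And>i. i \<in> {1..l} - {j} \<Longrightarrow> infdist (of_nat (m n) * x i) \<int> < 1 / l"
        unfolding almost_returns_def by blast
      have "1 / l \<le> 1 / K0" using \<open>l > K\<close> K0 by (intro divide_left_mono) (auto simp: K_def)
      then have "{1..k} - {j} \<subseteq> {i \<in> {1..k}. circle_norm (circle_scale (int (m n)) (\<alpha> i)) < \<epsilon>}"
        using j K0(2) \<open>l > K\<close> by (fastforce simp: x circle_norm_scale K_def)
      then have "card ({1..k} - {j}) \<le> card {i \<in> {1..k}. circle_norm (circle_scale (int (m n)) (\<alpha> i)) < \<epsilon>}"
        by (intro card_mono) auto
      moreover have "k - 1 \<le> card ({1..k} - {j})"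
        using card_Diff_singleton_if[of "{1..k}" j] by auto
      ultimately show "k - 1 \<le> card {i \<in> {1..k}. circle_norm (circle_scale (int (m n)) (\<alpha> i)) < \<epsilon>}"
        by linarith
    qed simp
  qed
  moreover have "infinite {n. n \<ge> 1 \<and> \<not> k dvd m n}" if "k \<ge> 2" for k
  proof
    assume "finite {n. n \<ge> 1 \<and> \<not> k dvd m n}"
    then have "finite (m ` {n. n \<ge> 1 \<and> \<not> k dvd m n})" by simp
    \<comment> \<open>Every element of \<open>S\<close> is a term of the sequence, so finitely many
      such indices would leave finitely many such values.\<close>
    moreover have "{s\<in>S. \<not> k dvd s} \<subseteq> m ` {n. n \<ge> 1 \<and> \<not> k dvd m n}"
      unfolding mS[symmetric] by auto
    ultimately show False using infd[OF that] finite_subset by blast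
  qed
  ultimately show ?thesis using mono by blast
qed

end
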